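(* Let $F$ and $G$ be subexponential distributions on $\mathbb{R}$. Let $p$ be any constant with $0<p<1$, and let $h$ be a positive function on $[0,\infty)$ such that $h(x)\le x/2$ for all sufficiently large $x$ and both $F$ and $G$ are $h$-insensitive. Then the following conditions are equivalent: (i) $\overline{F*G}(x)\sim\overline{F}(x)+\overline{G}(x)$ as $x\to\infty$; (ii) $F*G$ is subexponential; (iii) the mixture $pF+(1-p)G$ is subexponential; (iv) $\overline{F_{>h}*G_{>h}}(x)=o(\overline{F}(x)+\overline{G}(x))$ as $x\to\infty$.
   Context: A distribution is a (Borel) probability measure on $\mathbb{R}$. For a finite Borel measure $F$ on $\mathbb{R}$ the tail function is $\overline{F}(x)=F((x,\infty))$; $F*G$ denotes convolution, with tail $\overline{F*G}(x)=\int_{-\infty}^\infty\overline{F}(x-y)\,G(dy)$. The notation $f(x)\sim g(x)$ as $x\to\infty$ means $f(x)/g(x)\to1$. A finite measure $F$ on $\mathbb{R}$ is long-tailed if $\overline{F}(x)>0$ for all $x$ and, for every constant $a\in\mathbb{R}$, $\overline{F}(x+a)\sim\overline{F}(x)$ as $x\to\infty$. A distribution $F$ on $\mathbb{R}$ is subexponential if it is long-tailed and $\overline{F*F}(x)=2\overline{F}(x)+o(\overline{F}(x))$ as $x\to\infty$. A long-tailed measure $F$ is $h$-insensitive, for a positive function $h$ on $[0,\infty)$ with $h(x)\to\infty$ as $x\to\infty$, if $\overline{F}(x+h(x))\sim\overline{F}(x)$ and $\overline{F}(x-h(x))\sim\overline{F}(x)$ as $x\to\infty$. For a real number $t$, $F_{>t}$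 denotes the restriction of $F$ to $(t,\infty)$, i.e. $F_{>t}(A)=F(A\cap(t,\infty))$; the notation $\overline{F_{>h}*G_{>h}}(x)$ means the tail at $x$ of the convolution of $F_{>h(x)}$ and $G_{>h(x)}$, i.e. $(F_{>h(x)}*G_{>h(x)})((x,\infty))$. The mixture is $(pF+(1-p)G)(B)=pF(B)+(1-p)G(B)$ for Borel sets $B$. *)

theory Defs
  imports "HOL-Probability.Probability" "HOL-Library.Landau_Symbols"
begin

definition tail :: "real measure \<Rightarrow> real \<Rightarrow> real" where
  "tail F x = measure F {x<..}"

text \<open>The tail of a convolution is given by the usual integral formula.\<close>

lemma tail_convolution:
  assumes "finite_borel_measure F" "finite_borel_measure G"
  shows "tail (F \<star> G) x = (\<integral>y. tail F (x - y) \<partial>G)"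
proof -
  interpret F: finite_borel_measure F by fact
  interpret G: finite_borel_measure G by fact
  have sets[simp, measurable_cong]: "sets F = sets borel" "sets G = sets borel"
    using F.M_is_borel G.M_is_borel by simp_all
  have sp[simp]: "space F = UNIV" "space G = UNIV"
    using sets_eq_imp_space_eq[OF sets(1)] sets_eq_imp_space_eq[OF sets(2)] by simp_all
  have mono: "antimono (tail F)"
    unfolding tail_def by (intro antimonoI F.finite_measure_mono) auto
  have "mono (\<lambda>y. tail F (x - y))"
    using mono by (auto simp: monotone_def)
  then have [measurable]: "(\<lambda>y. tail F (x - y)) \<in> borel_measurable borel"
    by (rule borel_measurable_mono)
  have "emeasure (F \<star> G) {x<..} = emeasure (G \<star> F) {x<..}"
    by (subst convolution_commutative) (simp_all add: F.finite_measure_axioms G.finite_measure_axioms)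
  also have "\<dots> = (\<integral>\<^sup>+y. emeasure F {a. a + y \<in> {x<..}} \<partial>G)"
    by (subst convolution_emeasure) (simp_all add: F.finite_measure_axioms G.finite_measure_axioms)
  also have "\<dots> = (\<integral>\<^sup>+y. ennreal (tail F (x - y)) \<partial>G)"
  proof (rule nn_integral_cong)
    fix y
    have "{a. a + y \<in> {x<..}} = {x - y<..}" by auto
    then show "emeasure F {a. a + y \<in> {x<..}} = ennreal (tail F (x - y))"
      by (simp add: tail_def F.emeasure_eq_measure)
  qed
  finally have eq: "emeasure (F \<star> G) {x<..} = (\<integral>\<^sup>+y. ennreal (tail F (x - y)) \<partial>G)" .
  have "(\<integral>y. tail F (x - y) \<partial>G) = enn2real (\<integral>\<^sup>+y. ennreal (tail F (x - y)) \<partial>G)"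
  proof (rule integral_eq_nn_integral)
    show "(\<lambda>y. tail F (x - y)) \<in> borel_measurable G" by measurable
  qed (simp add: tail_def)
  with eq show ?thesis
    by (simp add: tail_def measure_def)
qed

definition long_tailed :: "real measure \<Rightarrow> bool" where
  "long_tailed F \<longleftrightarrow> finite_borel_measure F \<and> (\<forall>x. tail F x > 0) \<and>
     (\<forall>a. (\<lambda>x. tail F (x + a)) \<sim>[at_top] tail F)"

definition subexponential :: "real measure \<Rightarrow> bool" where
  "subexponential F \<longleftrightarrow> real_distribution F \<and> long_tailed F \<and>
     (\<lambda>x. tail (F \<star> F) x - 2 * tail F x) \<in> o[at_top](tail F)"

definition h_insensitive :: "(real \<Rightarrow> real) \<Rightarrow> real measure \<Rightarrow> bool" where
  "h_insensitive h F \<longleftrightarrow> long_tailed F \<and>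
     (\<lambda>x. tail F (x + h x)) \<sim>[at_top] tail F \<and>
     (\<lambda>x. tail F (x - h x)) \<sim>[at_top] tail F"

text \<open>The restriction to the half-line stays a measure on the whole real line (unlike
  \<^const>\<open>restrict_space\<close>), so that it can be convolved as a Borel measure.\<close>

definition restrict_gt :: "real measure \<Rightarrow> real \<Rightarrow> real measure" where
  "restrict_gt F t = density F (indicator {t<..})"

lemma sets_restrict_gt [simp]: "sets (restrict_gt F t) = sets F"
  by (simp add: restrict_gt_def)

lemma emeasure_restrict_gt:
  assumes "sets F = sets borel" "A \<in> sets borel"
  shows "emeasure (restrict_gt F t) A = emeasure F (A \<inter> {t<..})"
  using assms unfolding restrict_gt_def
  by (subst emeasure_restricted) (auto simp: Int_commute)

definition mixture :: "real \<Rightarrow> real measure \<Rightarrow> real measure \<Rightarrow> real measure" where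
  "mixture p F G = measure_of UNIV (sets borel)
     (\<lambda>B. ennreal p * emeasure F B + ennreal (1 - p) * emeasure G B)"

lemma sets_mixture [simp]: "sets (mixture p F G) = sets borel"
  unfolding mixture_def using sets.sigma_sets_eq[of "borel :: real measure"] by simp

lemma emeasure_mixture:
  assumes "sets F = sets borel" "sets G = sets borel" "B \<in> sets borel"
  shows "emeasure (mixture p F G) B = ennreal p * emeasure F B + ennreal (1 - p) * emeasure G B"
proof (rule emeasure_measure_of[OF mixture_def])
  show "B \<in> sets (mixture p F G)" using assms by simp
  show "countably_additive (sets (mixture p F G))
          (\<lambda>B. ennreal p * emeasure F B + ennreal (1 - p) * emeasure G B)"
  proof (rule countably_additiveI)
    fix A :: "nat \<Rightarrow> real set"
    assume A: "range A \<subseteq> sets (mixture p F G)" "disjoint_family A"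
    have "(\<Sum>i. emeasure F (A i)) = emeasure F (\<Union>i. A i)"
         "(\<Sum>i. emeasure G (A i)) = emeasure G (\<Union>i. A i)"
      using A assms(1,2) by (auto intro!: suminf_emeasure)
    then show "(\<Sum>i. ennreal p * emeasure F (A i) + ennreal (1 - p) * emeasure G (A i)) =
        ennreal p * emeasure F (\<Union>i. A i) + ennreal (1 - p) * emeasure G (\<Union>i. A i)"
      by (simp add: suminf_add[symmetric])
  qed
qed (auto simp: positive_def)

end

theory Submission
  imports Defs
begin

text \<open>
  Let \<open>X\<close> and \<open>Y\<close> be independent with laws \<open>F\<close> and \<open>G\<close>. If \<open>2 * h x \<le> x\<close>, the event
  \<open>X + Y > x\<close> splits into three disjoint parts, according to whether \<open>Y \<le> h x\<close>, or
  \<open>X \<le> h x\<close>, or both variables exceed \<open>h x\<close>. When \<open>F\<close> and \<open>G\<close> are \<open>h\<close>-insensitive, the first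
  two parts are asymptotic to \<open>tail F x\<close> and \<open>tail G x\<close>, because the variable that stays below
  \<open>h x\<close> perturbs the other one by an amount that its tail does not notice. Hence
  \<open>tail (F \<star> G)\<close> equals \<open>tail F + tail G\<close> plus the probability of the third part, up to
  \<open>o(tail F + tail G)\<close> (\<open>tail_convolution_expansion\<close>). That third probability is the
  quantity in (iv), so (i) and (iv) are equivalent. Taking \<open>F = G = H\<close> gives a test for a single
  law: an \<open>h\<close>-insensitive \<open>H\<close> is subexponential iff its joint tail with itself is \<open>o(tail H)\<close>.

  The joint tail is monotone in the tail of each of its two laws, because each law enters
  the Fubini integral only through its tail. So if \<open>tail H\<close> has the order of
  \<open>tail F + tail G\<close>, the joint tail of \<open>H\<close> with itself dominates that of \<open>F\<close> with \<open>G\<close>, and is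
  dominated by the joint tails of \<open>F\<close> with \<open>F\<close>, \<open>F\<close> with \<open>G\<close> and \<open>G\<close> with \<open>G\<close>. As \<open>F\<close> and
  \<open>G\<close> are subexponential, \<open>H\<close> is then subexponential exactly when (iv) holds
  (\<open>subexponential_iff_joint_tail_components\<close>). The mixture is such an \<open>H\<close>, which makes (iii)
  and (iv) equivalent; under (i) the convolution is such an \<open>H\<close>, which makes (i) imply (ii).

  For (ii) implies (i), the difficulty is that \<open>H = F \<star> G\<close> comes without insensitivity for the
  given \<open>h\<close>. But neither condition mentions \<open>h\<close>, so a slower function can be used for which
  \<open>F\<close>, \<open>G\<close> and \<open>H\<close> are all insensitive. The expansion bounds \<open>tail F + tail G\<close> by a multiple of
  \<open>tail H\<close>; by monotonicity the joint tail of \<open>F\<close> and \<open>G\<close> is at most a multiple of that of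
  \<open>H\<close> with itself, which is \<open>o(tail H)\<close>; and the expansion then reads (i)
  (\<open>asymp_equiv_of_subexponential_convolution\<close>).
\<close>

section \<open>Joint tails and domination\<close>

definition joint_tail :: "real measure \<Rightarrow> real measure \<Rightarrow> real \<Rightarrow> real \<Rightarrow> real" where
  "joint_tail F G t x = tail (restrict_gt F t \<star> restrict_gt G t) x"

lemma tail_nonneg [simp]: "0 \<le> tail F x"
  by (simp add: tail_def)

lemma joint_tail_nonneg [simp]: "0 \<le> joint_tail F G t x"
  by (simp add: joint_tail_def)

lemma tail_antimono: 
  assumes "finite_borel_measure F" "x \<le> y"
  shows "tail F y \<le> tail F x"
proof -
  interpret F: finite_borel_measure F by fact
  show ?thesis unfolding tail_def using assms(2) by (intro F.finite_measure_mono) auto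
qed

lemma space_finite_borel_measure:
  assumes "finite_borel_measure F"
  shows "space F = UNIV"
  using sets_eq_imp_space_eq[OF finite_borel_measure.M_is_borel[OF assms]] by simp

lemma finite_borel_measure_restrict_gt:
  assumes "finite_borel_measure F"
  shows "finite_borel_measure (restrict_gt F t)"
proof -
  interpret F: finite_borel_measure F by fact
  have "space F = UNIV"
    using assms by (rule space_finite_borel_measure)
  then have "emeasure (restrict_gt F t) UNIV = emeasure F {t<..}"
    by (subst emeasure_restrict_gt) (auto simp: F.M_is_borel)
  moreover have "space (restrict_gt F t) = UNIV"
    using \<open>space F = UNIV\<close> by (simp add: restrict_gt_def)
  ultimately have "finite_measure (restrict_gt F t)"
    by (intro finite_measureI) simp
  then show ?thesis
    by (simp add: finite_borel_measure_def finite_borel_measure_axioms_def F.M_is_borel)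
qed

lemma tail_restrict_gt:
  assumes "finite_borel_measure F"
  shows "tail (restrict_gt F t) x = tail F (max t x)"
proof -
  interpret F: finite_borel_measure F by fact
  have "{x<..} \<inter> {t<..} = {max t x<..}" by auto
  then show ?thesis
    by (simp add: tail_def measure_def emeasure_restrict_gt F.M_is_borel)
qed

lemma joint_tail_commute:
  assumes "finite_borel_measure F" "finite_borel_measure G"
  shows "joint_tail F G t x = joint_tail G F t x"
proof -
  interpret F: finite_borel_measure "restrict_gt F t"
    by (rule finite_borel_measure_restrict_gt) fact
  interpret G: finite_borel_measure "restrict_gt G t"
    by (rule finite_borel_measure_restrict_gt) fact
  show ?thesis unfolding joint_tail_def
    by (intro arg_cong[where f = "\<lambda>M. tail M x"] convolution_commutative
        F.finite_measure_axioms G.finite_measure_axioms F.M_is_borel G.M_is_borel)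
qed

lemma integrable_tail_shift:
  assumes "finite_borel_measure F" "finite_borel_measure G"
  shows "integrable G (\<lambda>y. tail F (x - y))"
proof -
  interpret F: finite_borel_measure F by fact
  interpret G: finite_borel_measure G by fact
  have "mono (\<lambda>y. tail F (x - y))"
    using tail_antimono[OF assms(1)] by (auto simp: monotone_def)
  then have "(\<lambda>y. tail F (x - y)) \<in> borel_measurable borel"
    by (rule borel_measurable_mono)
  then have "(\<lambda>y. tail F (x - y)) \<in> borel_measurable G"
    using measurable_cong_sets[OF G.M_is_borel refl] by blast
  then show ?thesis
    by (rule G.integrable_const_bound[where B = "measure F (space F)", rotated])
      (auto simp: tail_def F.bounded_measure)
qed

text \<open>The law that varies enters the convolution integral only through its tail, so a linear bound
  between tails passes to the convolutions.\<close>

lemma tail_convolution_dominated: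
  assumes fin: "finite_borel_measure A" "finite_borel_measure B" "finite_borel_measure C"
    "finite_borel_measure D"
  and le: "\<And>t. tail A t \<le> b * tail B t + c * tail C t"
  shows "tail (A \<star> D) x \<le> b * tail (B \<star> D) x + c * tail (C \<star> D) x"
proof -
  have "(\<integral>y. tail A (x - y) \<partial>D) \<le> (\<integral>y. b * tail B (x - y) + c * tail C (x - y) \<partial>D)"
    by (intro integral_mono Bochner_Integration.integrable_add integrable_mult_right
        integrable_tail_shift fin le)
  also have "\<dots> = b * (\<integral>y. tail B (x - y) \<partial>D) + c * (\<integral>y. tail C (x - y) \<partial>D)"
    by (simp add: integrable_tail_shift fin)
  finally show ?thesis by (simp add: tail_convolution fin)
qed

text \<open>Restriction to \<open>(t, \<infinity>)\<close> makes a tail constant below \<open>t\<close>, so the bound on the tails is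
  required only above \<open>t\<close>. This is what lets an asymptotic comparison of tails be used, as
  the threshold tends to infinity.\<close>

lemma joint_tail_dominated:
  assumes fin: "finite_borel_measure A" "finite_borel_measure B" "finite_borel_measure C"
    "finite_borel_measure D"
  and le: "\<And>s. t \<le> s \<Longrightarrow> tail A s \<le> b * tail B s + c * tail C s"
  shows "joint_tail A D t x \<le> b * joint_tail B D t x + c * joint_tail C D t x"
  unfolding joint_tail_def
  by (intro tail_convolution_dominated finite_borel_measure_restrict_gt fin)
    (simp add: tail_restrict_gt fin le)

text \<open>Passing to the product of the unrestricted measures puts the joint tail in the same space as
  the event \<open>X + Y > x\<close>, which is decomposed there.\<close>

lemma joint_tail_eq_measure_pair:
  assumes "finite_borel_measure F" "finite_borel_measure G"
  shows "joint_tail F G t x = measure (F \<Otimes>\<^sub>M G) {(u, v). t < u \<and> t < v \<and> x < u + v}"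
proof -
  interpret F: finite_borel_measure F by fact
  interpret G: finite_borel_measure G by fact
  interpret F': finite_borel_measure "restrict_gt F t"
    by (rule finite_borel_measure_restrict_gt) fact
  interpret G': finite_borel_measure "restrict_gt G t"
    by (rule finite_borel_measure_restrict_gt) fact
  note [measurable_cong] = F.M_is_borel G.M_is_borel
  have sp: "space F = UNIV" "space G = UNIV"
    by (rule space_finite_borel_measure[OF assms(1)], rule space_finite_borel_measure[OF assms(2)])
  have [measurable]: "{(u, v). t < u \<and> t < v \<and> x < u + v} \<in> sets (F \<Otimes>\<^sub>M G)"
  proof -
    have "{p \<in> space (F \<Otimes>\<^sub>M G). t < fst p \<and> t < snd p \<and> x < fst p + snd p} \<in> sets (F \<Otimes>\<^sub>M G)"
      by measurable
    then show ?thesis by (simp add: space_pair_measure sp case_prod_unfold)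
  qed
  have "emeasure (restrict_gt F t \<star> restrict_gt G t) {x<..} =
      (\<integral>\<^sup>+u. emeasure (restrict_gt G t) {v. v + u \<in> {x<..}} \<partial>restrict_gt F t)"
    by (rule convolution_emeasure)
      (simp_all add: F'.finite_measure_axioms G'.finite_measure_axioms F.M_is_borel G.M_is_borel
        space_finite_borel_measure finite_borel_measure_restrict_gt assms)
  also have "\<dots> = (\<integral>\<^sup>+u. emeasure G (Pair u -` {(u, v). t < u \<and> t < v \<and> x < u + v}) \<partial>F)"
  proof -
    have eq: "emeasure (restrict_gt G t) {v. v + u \<in> {x<..}} = emeasure G {max t (x - u)<..}" for u
    proof -
      have *: "{v. v + u \<in> {x<..}} = {x - u<..}" by auto
      moreover have "{x - u<..} \<inter> {t<..} = {max t (x - u)<..}" by auto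
      ultimately show ?thesis by (simp add: emeasure_restrict_gt G.M_is_borel)
    qed
    have "mono (\<lambda>u. tail G (max t (x - u)))"
      by (intro monoI tail_antimono assms(2)) auto
    then have "(\<lambda>u. tail G (max t (x - u))) \<in> borel_measurable borel"
      by (rule borel_measurable_mono)
    then have [measurable]: "(\<lambda>u. emeasure G {max t (x - u)<..}) \<in> borel_measurable borel"
      by (simp add: G.emeasure_eq_measure tail_def)
    have "(\<integral>\<^sup>+u. emeasure G {max t (x - u)<..} \<partial>restrict_gt F t) =
       (\<integral>\<^sup>+u. indicator {t<..} u * emeasure G {max t (x - u)<..} \<partial>F)"
      unfolding restrict_gt_def by (intro nn_integral_density) measurable
    also have "\<dots> = (\<integral>\<^sup>+u. emeasure G (Pair u -` {(u, v). t < u \<and> t < v \<and> x < u + v}) \<partial>F)"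
    proof (intro nn_integral_cong)
      fix u
      have "Pair u -` {(u, v). t < u \<and> t < v \<and> x < u + v} = 
        (if t < u then {max t (x - u)<..} else {})" by auto
      then show "indicator {t<..} u * emeasure G {max t (x - u)<..} =
        emeasure G (Pair u -` {(u, v). t < u \<and> t < v \<and> x < u + v})" by auto
    qed
    finally show ?thesis by (simp only: eq)
  qed
  also have "\<dots> = emeasure (F \<Otimes>\<^sub>M G) {(u, v). t < u \<and> t < v \<and> x < u + v}"
    by (subst G.emeasure_pair_measure_alt) auto
  finally show ?thesis by (simp add: joint_tail_def tail_def measure_def)
qed

section \<open>Expansion of the tail of a convolution\<close>

lemma real_distribution_convolution:
  assumes "real_distribution F" "real_distribution G"
  shows "real_distribution (F \<star> G)"
proof -
  interpret F: real_distribution F by fact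
  interpret G: real_distribution G by fact
  interpret P: pair_prob_space F G ..
  have "prob_space (F \<star> G)" unfolding convolution_def
    by (intro P.prob_space_distr) measurable
  then show ?thesis by (simp add: real_distribution_def real_distribution_axioms_def)
qed

text \<open>The numbers \<open>a\<close> and \<open>b\<close> are the probabilities of \<open>X + Y > x\<close> together with \<open>Y \<le> t\<close> and
  with \<open>X \<le> t\<close>; the two events are disjoint because \<open>2 * t \<le> x\<close>. Each contains one rectangle
  and lies in another, and the bounds are the measures of these rectangles.\<close>

lemma tail_convolution_split:
  assumes "real_distribution F" "real_distribution G" and "2 * t \<le> x"
  obtains a b where
    "tail (F \<star> G) x = a + b + joint_tail F G t x"
    "tail F (x + t) * measure G {-t<..t} \<le> a" "a \<le> tail F (x - t)"
    "tail G (x + t) * measure F {-t<..t} \<le> b" "b \<le> tail G (x - t)"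
proof -
  interpret F: real_distribution F by fact
  interpret G: real_distribution G by fact
  interpret P: pair_prob_space F G ..
  let ?P = "F \<Otimes>\<^sub>M G"
  define A where "A = {(u, v). v \<le> t \<and> x < u + v}"
  define B where "B = {(u, v). u \<le> t \<and> x < u + v}"
  define J where "J = {(u, v). t < u \<and> t < v \<and> x < u + v}"
  have "{p \<in> space ?P. snd p \<le> t \<and> x < fst p + snd p} \<in> sets ?P"
    "{p \<in> space ?P. fst p \<le> t \<and> x < fst p + snd p} \<in> sets ?P"
    "{p \<in> space ?P. t < fst p \<and> t < snd p \<and> x < fst p + snd p} \<in> sets ?P"
    by measurable
  then have [measurable]: "A \<in> sets ?P" "B \<in> sets ?P" "J \<in> sets ?P"
    by (simp_all add: A_def B_def J_def space_pair_measure case_prod_unfold)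
  have times: "measure ?P (S \<times> T) = measure F S * measure G T" 
    if "S \<in> sets borel" "T \<in> sets borel" for S T
    using that by (simp add: G.emeasure_pair_measure_Times measure_def enn2real_mult)
  have "tail (F \<star> G) x = measure ?P {(u, v). x < u + v}"
    unfolding tail_def convolution_def
    by (subst measure_distr) (auto simp: space_pair_measure vimage_def case_prod_unfold)
  also have "{(u, v). x < u + v} = A \<union> B \<union> J"
    unfolding A_def B_def J_def by auto
  also have "measure ?P \<dots> = measure ?P A + measure ?P B + measure ?P J"
  proof -
    have "measure ?P (A \<union> B \<union> J) = measure ?P (A \<union> B) + measure ?P J"
    proof (rule P.finite_measure_Union)
      show "(A \<union> B) \<inter> J = {}" by (auto simp: A_def B_def J_def)
    qed measurable
    moreover have "measure ?P (A \<union> B) = measure ?P A + measure ?P B"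
    proof (rule P.finite_measure_Union)
      show "A \<inter> B = {}" using assms(3) by (auto simp: A_def B_def)
    qed measurable
    ultimately show ?thesis by simp
  qed
  also have "measure ?P J = joint_tail F G t x"
    unfolding J_def using F.finite_borel_measure_M G.finite_borel_measure_M
    by (rule joint_tail_eq_measure_pair[symmetric])
  finally have "tail (F \<star> G) x = measure ?P A + measure ?P B + joint_tail F G t x" .
  moreover have "measure ?P ({x + t<..} \<times> {-t<..t}) \<le> measure ?P A"
    by (intro P.finite_measure_mono \<open>A \<in> sets ?P\<close>) (auto simp: A_def)
  moreover have "measure ?P A \<le> measure ?P ({x - t<..} \<times> UNIV)"
    by (rule P.finite_measure_mono) (auto simp: A_def)
  moreover have "measure ?P ({-t<..t} \<times> {x + t<..}) \<le> measure ?P B"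
    by (intro P.finite_measure_mono \<open>B \<in> sets ?P\<close>) (auto simp: B_def)
  moreover have "measure ?P B \<le> measure ?P (UNIV \<times> {x - t<..})"
    by (rule P.finite_measure_mono) (auto simp: B_def)
  ultimately show thesis
    using that F.prob_space G.prob_space by (simp add: times tail_def mult.commute)
qed

text \<open>The mass of \<open>G\<close> on \<open>(-h x, h x]\<close> tends to 1, so the bounds obtained from the rectangles are both
  asymptotic to the tail of \<open>F\<close>.\<close>

lemma asymp_equiv_of_insensitive_bounds:
  assumes "h_insensitive h F" "real_distribution G" "filterlim h at_top at_top"
    and "\<forall>\<^sub>F x in at_top. tail F (x + h x) * measure G {-h x<..h x} \<le> a x \<and> a x \<le> tail F (x - h x)"
  shows "a \<sim>[at_top] tail F"
proof (rule asymp_equiv_sandwich_real)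
  interpret G: real_distribution G by fact
  have "((\<lambda>x. cdf G (h x)) \<longlongrightarrow> 1) at_top"
    by (rule filterlim_compose[OF G.cdf_lim_at_top_prob assms(3)])
  moreover have "filterlim (\<lambda>x. - h x) at_bot at_top"
    using assms(3) by (simp add: filterlim_uminus_at_top)
  then have "((\<lambda>x. cdf G (- h x)) \<longlongrightarrow> 0) at_top"
    by (rule filterlim_compose[OF G.cdf_lim_at_bot])
  ultimately have "((\<lambda>x. cdf G (h x) - cdf G (- h x)) \<longlongrightarrow> 1 - 0) at_top"
    by (rule tendsto_diff)
  moreover have "\<forall>\<^sub>F x in at_top. cdf G (h x) - cdf G (- h x) = measure G {-h x<..h x}"
    using filterlim_at_top_dense[THEN iffD1, OF assms(3), rule_format, of 0]
    by eventually_elim (simp add: G.cdf_diff_eq)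
  ultimately have "((\<lambda>x. measure G {-h x<..h x}) \<longlongrightarrow> 1) at_top"
    by (auto elim: Lim_transform_eventually)
  then have "(\<lambda>x. measure G {-h x<..h x}) \<sim>[at_top] (\<lambda>_. 1)"
    by (intro tendsto_imp_asymp_equiv_const) auto
  then have "(\<lambda>x. tail F (x + h x) * measure G {-h x<..h x}) \<sim>[at_top] (\<lambda>x. tail F x * 1)"
    using assms(1) by (intro asymp_equiv_mult) (auto simp: h_insensitive_def)
  then show "(\<lambda>x. tail F (x + h x) * measure G {-h x<..h x}) \<sim>[at_top] tail F" by simp
  show "(\<lambda>x. tail F (x - h x)) \<sim>[at_top] tail F"
    using assms(1) by (simp add: h_insensitive_def)
  show "\<forall>\<^sub>F x in at_top. a x \<in> {tail F (x + h x) * measure G {-h x<..h x}..tail F (x - h x)}"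
    using assms(4) by simp
qed

lemma tail_bigo_add:
  "tail F \<in> O[at_top](\<lambda>x. tail F x + tail G x)" "tail G \<in> O[at_top](\<lambda>x. tail F x + tail G x)"
  by (auto intro!: bigoI[where c = 1])

lemma tail_convolution_expansion:
  assumes dist: "real_distribution F" "real_distribution G"
    and ins: "h_insensitive h F" "h_insensitive h G"
    and h: "filterlim h at_top at_top" "\<forall>\<^sub>F x in at_top. h x \<le> x / 2"
  shows "(\<lambda>x. tail (F \<star> G) x - (tail F x + tail G x) - joint_tail F G (h x) x)
    \<in> o[at_top](\<lambda>x. tail F x + tail G x)"
proof -
  have "\<forall>x. \<exists>a b. 2 * h x \<le> x \<longrightarrow> tail (F \<star> G) x = a + b + joint_tail F G (h x) x \<and>
      (tail F (x + h x) * measure G {- h x<..h x} \<le> a \<and> a \<le> tail F (x - h x)) \<and>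
      (tail G (x + h x) * measure F {- h x<..h x} \<le> b \<and> b \<le> tail G (x - h x))"
    using tail_convolution_split[OF dist] by metis
  then obtain a b where ab: "\<And>x. 2 * h x \<le> x \<Longrightarrow>
      tail (F \<star> G) x = a x + b x + joint_tail F G (h x) x \<and>
      (tail F (x + h x) * measure G {- h x<..h x} \<le> a x \<and> a x \<le> tail F (x - h x)) \<and>
      (tail G (x + h x) * measure F {- h x<..h x} \<le> b x \<and> b x \<le> tail G (x - h x))"
    by metis
  have ev: "\<forall>\<^sub>F x in at_top. 2 * h x \<le> x"
    using h(2) by eventually_elim simp
  have "a \<sim>[at_top] tail F"
    by (rule asymp_equiv_of_insensitive_bounds[OF ins(1) dist(2) h(1)]) (use ev ab in \<open>auto elim: eventually_mono\<close>)
  moreover have "b \<sim>[at_top] tail G"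
    by (rule asymp_equiv_of_insensitive_bounds[OF ins(2) dist(1) h(1)]) (use ev ab in \<open>auto elim: eventually_mono\<close>)
  ultimately have "(\<lambda>x. (a x - tail F x) + (b x - tail G x)) \<in> o[at_top](\<lambda>x. tail F x + tail G x)"
    by (intro sum_in_smallo landau_o.small_big_trans[OF _ tail_bigo_add(1)]
        landau_o.small_big_trans[OF _ tail_bigo_add(2)] asymp_equiv_imp_diff_smallo)
  moreover have "\<forall>\<^sub>F x in at_top. (a x - tail F x) + (b x - tail G x) =
      tail (F \<star> G) x - (tail F x + tail G x) - joint_tail F G (h x) x"
    using ev by eventually_elim (use ab in auto)
  ultimately show ?thesis
    by (rule landau_o.small.in_cong[THEN iffD1, rotated])
qed

lemma asymp_equiv_convolution_iff_joint_tail: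
  assumes "real_distribution F" "real_distribution G" "h_insensitive h F" "h_insensitive h G"
    and "filterlim h at_top at_top" "\<forall>\<^sub>F x in at_top. h x \<le> x / 2"
  shows "tail (F \<star> G) \<sim>[at_top] (\<lambda>x. tail F x + tail G x) \<longleftrightarrow>
    (\<lambda>x. joint_tail F G (h x) x) \<in> o[at_top](\<lambda>x. tail F x + tail G x)"
proof -
  let ?S = "\<lambda>x. tail F x + tail G x" and ?J = "\<lambda>x. joint_tail F G (h x) x"
  have E: "(\<lambda>x. tail (F \<star> G) x - ?S x - ?J x) \<in> o[at_top](?S)"
    by (rule tail_convolution_expansion[OF assms])
  show ?thesis unfolding asymp_equiv_altdef
  proof
    assume "(\<lambda>x. tail (F \<star> G) x - ?S x) \<in> o[at_top](?S)"
    from sum_in_smallo(2)[OF this E] show "?J \<in> o[at_top](?S)" by simp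
  next
    assume "?J \<in> o[at_top](?S)"
    from sum_in_smallo(1)[OF E this] show "(\<lambda>x. tail (F \<star> G) x - ?S x) \<in> o[at_top](?S)" by simp
  qed
qed

text \<open>This is the expansion with both laws equal to \<open>H\<close>: subexponentiality of an insensitive law says
  that two independent copies exceed \<open>h x\<close> simultaneously, with sum above \<open>x\<close>, only with
  negligible probability.\<close>

lemma subexponential_iff_joint_tail:
  assumes "real_distribution H" "h_insensitive h H"
    and "filterlim h at_top at_top" "\<forall>\<^sub>F x in at_top. h x \<le> x / 2"
  shows "subexponential H \<longleftrightarrow> (\<lambda>x. joint_tail H H (h x) x) \<in> o[at_top](tail H)"
proof -
  have "o[at_top](\<lambda>x. 2 * tail H x) = o[at_top](tail H)" by simp
  then show ?thesis
    using asymp_equiv_convolution_iff_joint_tail[OF assms(1,1,2,2,3,4)] assms(1,2)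
    by (simp add: subexponential_def h_insensitive_def asymp_equiv_altdef flip: mult_2)
qed

section \<open>Subexponentiality of laws with the tail order of a sum\<close>

lemma eventually_joint_tail_dominated:
  assumes fin: "finite_borel_measure A" "finite_borel_measure B" "finite_borel_measure C"
    "finite_borel_measure D"
  and h: "filterlim h at_top at_top"
  and le: "\<forall>\<^sub>F s in at_top. tail A s \<le> b * tail B s + c * tail C s"
  shows "\<forall>\<^sub>F x in at_top.
    joint_tail A D (h x) x \<le> b * joint_tail B D (h x) x + c * joint_tail C D (h x) x"
proof -
  obtain N where N: "\<And>s. N \<le> s \<Longrightarrow> tail A s \<le> b * tail B s + c * tail C s"
    using le by (auto simp: eventually_at_top_linorder)
  have "\<forall>\<^sub>F x in at_top. N \<le> h x"
    using h by (simp add: filterlim_at_top)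
  then show ?thesis
    by eventually_elim (intro joint_tail_dominated fin N, simp)
qed

lemma tail_bigoE:
  assumes "tail F \<in> O[at_top](tail H)"
  obtains d where "0 < d" "\<forall>\<^sub>F x in at_top. tail F x \<le> d * tail H x"
  using assms by (elim landau_o.bigE) auto

text \<open>Domination is applied once in each argument; commutativity moves the second law into the
  first place.\<close>

lemma joint_tail_bigo_square:
  assumes fin: "finite_borel_measure F" "finite_borel_measure G" "finite_borel_measure H"
    and h: "filterlim h at_top at_top"
    and O: "tail F \<in> O[at_top](tail H)" "tail G \<in> O[at_top](tail H)"
  shows "(\<lambda>x. joint_tail F G (h x) x) \<in> O[at_top](\<lambda>x. joint_tail H H (h x) x)"
proof -
  obtain c where c: "0 < c" "\<forall>\<^sub>F x in at_top. tail F x \<le> c * tail H x"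
    using O(1) by (rule tail_bigoE)
  obtain d where d: "0 < d" "\<forall>\<^sub>F x in at_top. tail G x \<le> d * tail H x"
    using O(2) by (rule tail_bigoE)
  have "\<forall>\<^sub>F x in at_top. joint_tail F G (h x) x \<le> c * joint_tail H G (h x) x"
    using eventually_joint_tail_dominated[OF fin(1,3,3,2) h, of c 0] c by simp
  moreover have "\<forall>\<^sub>F x in at_top. joint_tail G H (h x) x \<le> d * joint_tail H H (h x) x"
    using eventually_joint_tail_dominated[OF fin(2,3,3,3) h, of d 0] d by simp
  ultimately have "\<forall>\<^sub>F x in at_top. joint_tail F G (h x) x \<le> (c * d) * joint_tail H H (h x) x"
  proof eventually_elim
    case (elim x)
    have "joint_tail F G (h x) x \<le> c * joint_tail G H (h x) x"
      using elim(1) joint_tail_commute[OF fin(2,3)] by simp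
    also have "\<dots> \<le> c * (d * joint_tail H H (h x) x)"
      using elim(2) c(1) by (intro mult_left_mono) auto
    finally show ?case by (simp add: mult.assoc)
  qed
  then show ?thesis
    by (intro bigoI[where c = "c * d"]) (auto elim: eventually_mono)
qed

text \<open>Only the order of magnitude of \<open>tail H\<close> matters, so this lemma serves the mixture and the
  convolution alike, and contains the closure of subexponentiality under equivalence of tails.
  From left to right the joint tail of \<open>F\<close> and \<open>G\<close> is dominated by that of \<open>H\<close> with itself. From
  right to left the latter expands bilinearly, and the two diagonal terms are
  negligible by the subexponentiality of \<open>F\<close> and \<open>G\<close>.\<close>

lemma subexponential_iff_joint_tail_components:
  assumes sub: "subexponential F" "subexponential G"
    and ins: "h_insensitive h F" "h_insensitive h G"
    and H: "real_distribution H" "h_insensitive h H"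
    and h: "filterlim h at_top at_top" "\<forall>\<^sub>F x in at_top. h x \<le> x / 2"
    and order: "tail H \<in> \<Theta>[at_top](\<lambda>x. tail F x + tail G x)"
  shows "subexponential H \<longleftrightarrow>
    (\<lambda>x. joint_tail F G (h x) x) \<in> o[at_top](\<lambda>x. tail F x + tail G x)"
proof -
  let ?S = "\<lambda>x. tail F x + tail G x"
  have dist: "real_distribution F" "real_distribution G"
    using sub by (auto simp: subexponential_def)
  have fin: "finite_borel_measure F" "finite_borel_measure G" "finite_borel_measure H"
    using dist H(1) by (auto simp: real_distribution.finite_borel_measure_M)
  have S: "?S \<in> O[at_top](tail H)" and HS: "tail H \<in> O[at_top](?S)"
    using order bigthetaD1 bigtheta_sym by blast+
  have oS: "o[at_top](tail H) = o[at_top](?S)"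
    using order by (rule landau_o.small.cong_bigtheta)
  have iff: "subexponential H \<longleftrightarrow> (\<lambda>x. joint_tail H H (h x) x) \<in> o[at_top](?S)"
    using subexponential_iff_joint_tail[OF H h] by (simp only: oS)
  show ?thesis unfolding iff
  proof
    assume *: "(\<lambda>x. joint_tail H H (h x) x) \<in> o[at_top](?S)"
    have "(\<lambda>x. joint_tail F G (h x) x) \<in> O[at_top](\<lambda>x. joint_tail H H (h x) x)"
      by (rule joint_tail_bigo_square[OF fin h(1)])
        (rule landau_o.big_trans[OF tail_bigo_add(1) S],
         rule landau_o.big_trans[OF tail_bigo_add(2) S])
    then show "(\<lambda>x. joint_tail F G (h x) x) \<in> o[at_top](?S)"
      using * by (rule landau_o.big_small_trans)
  next
    assume FG: "(\<lambda>x. joint_tail F G (h x) x) \<in> o[at_top](?S)"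
    have FF: "(\<lambda>x. joint_tail F F (h x) x) \<in> o[at_top](?S)"
      using subexponential_iff_joint_tail[OF dist(1) ins(1) h] sub(1)
      by (blast intro: landau_o.small_big_trans tail_bigo_add)
    have GG: "(\<lambda>x. joint_tail G G (h x) x) \<in> o[at_top](?S)"
      using subexponential_iff_joint_tail[OF dist(2) ins(2) h] sub(2)
      by (blast intro: landau_o.small_big_trans tail_bigo_add)
    obtain c where c: "0 < c" "\<forall>\<^sub>F x in at_top. tail H x \<le> c * tail F x + c * tail G x"
      using HS by (elim landau_o.bigE) (auto simp: distrib_left)
    let ?R = "\<lambda>x. joint_tail F F (h x) x + 2 * joint_tail F G (h x) x + joint_tail G G (h x) x"
    note dom = eventually_joint_tail_dominated[OF fin(3,1,2) _ h(1) c(2)]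
    have "\<forall>\<^sub>F x in at_top. joint_tail H H (h x) x \<le> c\<^sup>2 * ?R x"
      using dom[OF fin(1)] dom[OF fin(2)] dom[OF fin(3)]
    proof eventually_elim
      case (elim x)
      have "joint_tail H H (h x) x \<le> c * joint_tail H F (h x) x + c * joint_tail H G (h x) x"
        using elim(3) joint_tail_commute[OF fin(3,1)] joint_tail_commute[OF fin(3,2)] by simp
      also have "\<dots> \<le> c * (c * joint_tail F F (h x) x + c * joint_tail G F (h x) x) +
          c * (c * joint_tail F G (h x) x + c * joint_tail G G (h x) x)"
        using elim(1,2) c(1) by (intro add_mono mult_left_mono) auto
      also have "\<dots> = c\<^sup>2 * ?R x"
        using joint_tail_commute[OF fin(1,2)] by (simp add: power2_eq_square algebra_simps)
      finally show ?case .
    qed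
    then have "(\<lambda>x. joint_tail H H (h x) x) \<in> O[at_top](?R)"
      by (intro bigoI[where c = "c\<^sup>2"]) (auto elim: eventually_mono)
    moreover have "?R \<in> o[at_top](?S)"
      using FF FG GG by (intro sum_in_smallo) auto
    ultimately show "(\<lambda>x. joint_tail H H (h x) x) \<in> o[at_top](?S)"
      by (rule landau_o.big_small_trans)
  qed
qed

section \<open>Insensitivity\<close>

lemma asymp_equiv_tail_combination:
  assumes "(\<lambda>x. tail F (u x)) \<sim>[at_top] tail F" "(\<lambda>x. tail G (u x)) \<sim>[at_top] tail G"
    and "0 < a" "0 < b"
  shows "(\<lambda>x. a * tail F (u x) + b * tail G (u x)) \<sim>[at_top] (\<lambda>x. a * tail F x + b * tail G x)"
proof -
  let ?S = "\<lambda>x. a * tail F x + b * tail G x"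
  have F: "tail F \<in> O[at_top](?S)"
    using assms(3,4) by (intro bigoI[where c = "1 / a"]) (auto simp: field_simps)
  have G: "tail G \<in> O[at_top](?S)"
    using assms(3,4) by (intro bigoI[where c = "1 / b"]) (auto simp: field_simps)
  have "(\<lambda>x. tail F (u x) - tail F x) \<in> o[at_top](?S)"
    by (rule landau_o.small_big_trans[OF asymp_equiv_imp_diff_smallo[OF assms(1)] F])
  moreover have "(\<lambda>x. tail G (u x) - tail G x) \<in> o[at_top](?S)"
    by (rule landau_o.small_big_trans[OF asymp_equiv_imp_diff_smallo[OF assms(2)] G])
  ultimately have
    "(\<lambda>x. a * (tail F (u x) - tail F x) + b * (tail G (u x) - tail G x)) \<in> o[at_top](?S)"
    using assms(3,4) by (intro sum_in_smallo) simp_all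
  then show ?thesis
    by (simp add: asymp_equiv_altdef algebra_simps)
qed

lemma half_at_top: "filterlim (\<lambda>x::real. x / 2) at_top at_top"
  using filterlim_tendsto_pos_mult_at_top[OF tendsto_const[of "1/2::real"] _ filterlim_ident]
  by simp

text \<open>An asymptotic relation between tails survives any shift of the argument that still tends to
  infinity. For the shift to \<open>x - h x\<close> this is where \<open>h x \<le> x / 2\<close> enters.\<close>

lemma h_insensitive_of_tail_combination:
  assumes ins: "h_insensitive h F" "h_insensitive h G"
    and H: "finite_borel_measure H" "tail H \<sim>[at_top] (\<lambda>x. a * tail F x + b * tail G x)"
    and ab: "0 < a" "0 < b"
    and h: "filterlim h at_top at_top" "\<forall>\<^sub>F x in at_top. h x \<le> x / 2"
  shows "h_insensitive h H"
proof -
  let ?S = "\<lambda>x. a * tail F x + b * tail G x"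
  have lt: "long_tailed F" "long_tailed G"
    using ins by (auto simp: h_insensitive_def)
  have shift: "(\<lambda>x. tail H (u x)) \<sim>[at_top] tail H"
    if u: "filterlim u at_top at_top"
      "(\<lambda>x. tail F (u x)) \<sim>[at_top] tail F" "(\<lambda>x. tail G (u x)) \<sim>[at_top] tail G" for u
  proof -
    have "(\<lambda>x. tail H (u x)) \<sim>[at_top] (\<lambda>x. ?S (u x))"
      using H(2) u(1) by (rule asymp_equiv_compose')
    also have "(\<lambda>x. ?S (u x)) \<sim>[at_top] ?S"
      using u(2,3) ab by (rule asymp_equiv_tail_combination)
    also have "?S \<sim>[at_top] tail H"
      using H(2) by (rule asymp_equiv_symI)
    finally show ?thesis .
  qed
  have S_pos: "0 < ?S x" for x
    using lt ab by (simp add: long_tailed_def add_pos_pos)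
  \<comment> \<open>The asymptotic relation gives positivity only for large arguments; a tail is
     nonincreasing, so it is positive everywhere.\<close>
  have "\<forall>\<^sub>F x in at_top. tail H x \<noteq> 0"
    using asymp_equiv_eventually_zeros[OF H(2)] 
    by eventually_elim (use S_pos in \<open>metis less_irrefl\<close>)
  then have pos: "0 < tail H x" for x
  proof -
    have "\<forall>\<^sub>F y in at_top. tail H y \<noteq> 0 \<and> x \<le> y"
      using \<open>\<forall>\<^sub>F x in at_top. tail H x \<noteq> 0\<close> eventually_ge_at_top[of x] by eventually_elim simp
    then obtain y where "tail H y \<noteq> 0" "x \<le> y"
      by (auto simp: eventually_at_top_linorder)
    then show ?thesis
      using tail_antimono[OF H(1), of x y] tail_nonneg[of H y] by linarith
  qed
  have "(\<lambda>x. tail H (x + c)) \<sim>[at_top] tail H" for c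
    using lt by (intro shift filterlim_tendsto_add_at_top[OF tendsto_const filterlim_ident, 
          of c, unfolded add.commute[of c]])
       (auto simp: long_tailed_def)
  moreover have "filterlim (\<lambda>x. x + h x) at_top at_top"
    by (intro filterlim_at_top_add_at_top filterlim_ident h(1))
  then have "(\<lambda>x. tail H (x + h x)) \<sim>[at_top] tail H"
    using ins by (intro shift) (auto simp: h_insensitive_def)
  moreover have "filterlim (\<lambda>x. x - h x) at_top at_top"
  proof (rule filterlim_at_top_mono)
    show "filterlim (\<lambda>x::real. x / 2) at_top at_top" by (rule half_at_top)
    show "\<forall>\<^sub>F x in at_top. x / 2 \<le> x - h x"
      using h(2) by eventually_elim simp
  qed
  then have "(\<lambda>x. tail H (x - h x)) \<sim>[at_top] tail H"
    using ins by (intro shift) (auto simp: h_insensitive_def)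
  ultimately show ?thesis
    using H(1) pos by (simp add: h_insensitive_def long_tailed_def)
qed

lemma h_insensitive_mono:
  assumes "h_insensitive h F" "\<forall>\<^sub>F x in at_top. 0 \<le> k x \<and> k x \<le> h x"
  shows "h_insensitive k F"
proof -
  have fin: "finite_borel_measure F"
    using assms(1) by (simp add: h_insensitive_def long_tailed_def)
  have "(\<lambda>x. tail F (x + k x)) \<sim>[at_top] tail F"
  proof (rule asymp_equiv_sandwich_real)
    show "\<forall>\<^sub>F x in at_top. tail F (x + k x) \<in> {tail F (x + h x)..tail F x}"
      using assms(2) by eventually_elim (auto intro!: tail_antimono[OF fin])
  qed (use assms(1) in \<open>auto simp: h_insensitive_def\<close>)
  moreover have "(\<lambda>x. tail F (x - k x)) \<sim>[at_top] tail F"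
  proof (rule asymp_equiv_sandwich_real)
    show "\<forall>\<^sub>F x in at_top. tail F (x - k x) \<in> {tail F x..tail F (x - h x)}"
      using assms(2) by eventually_elim (auto intro!: tail_antimono[OF fin])
  qed (use assms(1) in \<open>auto simp: h_insensitive_def\<close>)
  ultimately show ?thesis
    using assms(1) by (simp add: h_insensitive_def)
qed

text \<open>If each \<open>P n\<close> holds eventually, the largest \<open>n \<le> x\<close> with \<open>P n x\<close> tends to infinity with
  \<open>x\<close>. The bound \<open>n \<le> x\<close> makes the maximum exist.\<close>

lemma eventually_diagonal:
  fixes P :: "nat \<Rightarrow> real \<Rightarrow> bool"
  assumes "\<And>n. \<forall>\<^sub>F x in at_top. P n x"
  obtains N :: "real \<Rightarrow> nat" where "filterlim N at_top at_top" "\<forall>\<^sub>F x in at_top. P (N x) x"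
proof
  define A where "A x = {n. real n \<le> x \<and> P n x}" for x
  define N where "N x = Max (A x)" for x
  have fin: "finite (A x)" for x
  proof (rule finite_subset)
    show "A x \<subseteq> {..nat \<lfloor>x\<rfloor>}" by (auto simp: A_def le_nat_floor)
  qed simp
  have ev: "\<forall>\<^sub>F x in at_top. n \<in> A x" for n
    using assms[of n] eventually_ge_at_top[of "real n"] 
    by eventually_elim (simp add: A_def)
  show "filterlim N at_top at_top"
    unfolding filterlim_at_top
  proof
    fix n show "\<forall>\<^sub>F x in at_top. n \<le> N x"
      using ev[of n] by eventually_elim (simp add: N_def fin)
  qed
  show "\<forall>\<^sub>F x in at_top. P (N x) x"
    using ev[of 0]
  proof eventually_elim
    case (elim x)
    then have "N x \<in> A x" unfolding N_def by (intro Max_in fin) auto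
    then show ?case by (simp add: A_def)
  qed
qed

text \<open>A long-tailed law absorbs every constant shift \<open>n\<close> with relative error at most
  \<open>1 / (n + 1)\<close> from some point on. A shift that grows slowly enough passes all these points
  in time.\<close>

lemma long_tailed_insensitive_below:
  assumes F: "long_tailed F" and h: "filterlim h at_top at_top"
  obtains k where "filterlim k at_top at_top" "\<forall>\<^sub>F x in at_top. k x \<le> h x" "h_insensitive k F"
proof -
  define P where "P n x \<longleftrightarrow> real n \<le> h x \<and>
      \<bar>tail F (x + real n) - tail F x\<bar> \<le> tail F x / real (Suc n) \<and>
      \<bar>tail F (x - real n) - tail F x\<bar> \<le> tail F x / real (Suc n)" for n x
  have "\<forall>\<^sub>F x in at_top. P n x" for n
  proof -
    have shift: "\<forall>\<^sub>F x in at_top. \<bar>tail F (x + a) - tail F x\<bar> \<le> tail F x / real (Suc n)" for a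
    proof -
      have "(\<lambda>x. tail F (x + a) - tail F x) \<in> o[at_top](tail F)"
        using F by (auto simp: long_tailed_def intro: asymp_equiv_imp_diff_smallo)
      from landau_o.smallD[OF this, of "1 / real (Suc n)"] show ?thesis by simp
    qed
    have "\<forall>\<^sub>F x in at_top. real n \<le> h x"
      using h by (simp add: filterlim_at_top)
    then show ?thesis
      using shift[of "real n"] shift[of "- real n"]
      by eventually_elim (simp add: P_def)
  qed
  then obtain N where N: "filterlim N at_top at_top" "\<forall>\<^sub>F x in at_top. P (N x) x"
    by (rule eventually_diagonal)
  have lim: "filterlim (\<lambda>x. real (N x)) at_top at_top"
    by (rule filterlim_compose[OF filterlim_real_sequentially N(1)])
  have small: "(\<lambda>x. f x - tail F x) \<in> o[at_top](tail F)"
    if "\<forall>\<^sub>F x in at_top. \<bar>f x - tail F x\<bar> \<le> tail F x / real (Suc (N x))" for f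
  proof (rule landau_o.smallI)
    fix c :: real assume c: "0 < c"
    have "\<forall>\<^sub>F x in at_top. 1 / c \<le> real (N x)"
      using lim by (simp add: filterlim_at_top)
    with that show "\<forall>\<^sub>F x in at_top. norm (f x - tail F x) \<le> c * norm (tail F x)"
    proof eventually_elim
      case (elim x)
      have "1 / real (Suc (N x)) \<le> c"
        using elim(2) c by (simp add: field_simps) 
      then have "tail F x * (1 / real (Suc (N x))) \<le> tail F x * c"
        by (intro mult_left_mono) auto
      with elim(1) show ?case by (simp add: mult.commute)
    qed
  qed
  show thesis
  proof
    show "filterlim (\<lambda>x. real (N x)) at_top at_top" by (fact lim)
    show "\<forall>\<^sub>F x in at_top. real (N x) \<le> h x"
      using N(2) by eventually_elim (simp add: P_def)
    show "h_insensitive (\<lambda>x. real (N x)) F"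
      unfolding h_insensitive_def asymp_equiv_altdef
    proof (intro conjI F small)
      show "\<forall>\<^sub>F x in at_top. \<bar>tail F (x + real (N x)) - tail F x\<bar> \<le> tail F x / real (Suc (N x))"
        "\<forall>\<^sub>F x in at_top. \<bar>tail F (x - real (N x)) - tail F x\<bar> \<le> tail F x / real (Suc (N x))"
        using N(2) by (eventually_elim, simp add: P_def)+
    qed
  qed
qed

text \<open>A slower function is chosen for each law in turn; insensitivity for the earlier laws survives
  by monotonicity.\<close>

lemma common_insensitive_function:
  assumes "long_tailed F" "long_tailed G" "long_tailed H"
  obtains h where "filterlim h at_top at_top" "\<forall>\<^sub>F x in at_top. h x \<le> x / 2"
    "h_insensitive h F" "h_insensitive h G" "h_insensitive h H"
proof -
  have nonneg: "\<forall>\<^sub>F x in at_top. 0 \<le> k x" if "filterlim k at_top at_top" for k :: "real \<Rightarrow> real"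
    using that by (simp add: filterlim_at_top)
  obtain k1 where k1: "filterlim k1 at_top at_top" "\<forall>\<^sub>F x in at_top. k1 x \<le> x / 2"
    "h_insensitive k1 F"
    by (rule long_tailed_insensitive_below[OF assms(1) half_at_top])
  obtain k2 where k2: "filterlim k2 at_top at_top" "\<forall>\<^sub>F x in at_top. k2 x \<le> k1 x"
    "h_insensitive k2 G"
    by (rule long_tailed_insensitive_below[OF assms(2) k1(1)])
  obtain k where k: "filterlim k at_top at_top" "\<forall>\<^sub>F x in at_top. k x \<le> k2 x"
    "h_insensitive k H"
    by (rule long_tailed_insensitive_below[OF assms(3) k2(1)])
  show thesis
  proof
    show "\<forall>\<^sub>F x in at_top. k x \<le> x / 2"
      using k1(2) k2(2) k(2) by eventually_elim simp
    show "h_insensitive k F"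
      by (rule h_insensitive_mono[OF k1(3)])
        (use nonneg[OF k(1)] k2(2) k(2) in \<open>eventually_elim, simp\<close>)
    show "h_insensitive k G"
      by (rule h_insensitive_mono[OF k2(3)])
        (use nonneg[OF k(1)] k(2) in \<open>eventually_elim, simp\<close>)
  qed (use k in auto)
qed

section \<open>Subexponential convolutions and mixtures\<close>

text \<open>A subexponential convolution leaves no room for the joint tail: \<open>tail F\<close> and \<open>tail G\<close> are at
  most of the order of \<open>tail (F \<star> G)\<close>, so the joint tail of \<open>F\<close> and \<open>G\<close> is bounded by a
  multiple of the joint tail of \<open>F \<star> G\<close> with itself, which is negligible.\<close>

lemma asymp_equiv_of_subexponential_convolution:
  assumes F: "real_distribution F" "long_tailed F" and G: "real_distribution G" "long_tailed G"
    and H: "subexponential (F \<star> G)"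
  shows "tail (F \<star> G) \<sim>[at_top] (\<lambda>x. tail F x + tail G x)"
proof -
  let ?H = "F \<star> G" and ?S = "\<lambda>x. tail F x + tail G x"
  have Hd: "real_distribution ?H" "long_tailed ?H"
    using H by (auto simp: subexponential_def)
  obtain h where h: "filterlim h at_top at_top" "\<forall>\<^sub>F x in at_top. h x \<le> x / 2"
    and ins: "h_insensitive h F" "h_insensitive h G" "h_insensitive h ?H"
    using common_insensitive_function[OF F(2) G(2) Hd(2)] .
  let ?J = "\<lambda>x. joint_tail F G (h x) x"
  note E = tail_convolution_expansion[OF F(1) G(1) ins(1,2) h]
  \<comment> \<open>The joint tail is nonnegative, so the expansion gives \<open>tail ?H \<ge> (1 + o(1)) * ?S\<close>; any factor
     above 1 would do.\<close>
  have "\<forall>\<^sub>F x in at_top. ?S x \<le> 2 * tail ?H x"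
    using landau_o.smallD[OF E, of "1/2"]
  proof (rule eventually_mono)
    fix x
    assume "norm (tail ?H x - ?S x - ?J x) \<le> 1 / 2 * norm (?S x)"
    moreover have "norm (?S x) = ?S x" by simp
    moreover have "- (tail ?H x - ?S x - ?J x) \<le> norm (tail ?H x - ?S x - ?J x)" by simp
    moreover have "0 \<le> ?J x" by simp
    ultimately show "?S x \<le> 2 * tail ?H x" by linarith
  qed simp
  then have S: "?S \<in> O[at_top](tail ?H)"
    by (intro bigoI[where c = 2]) (auto elim: eventually_mono)
  have "?J \<in> O[at_top](\<lambda>x. joint_tail ?H ?H (h x) x)"
    using F(1) G(1) Hd(1) h(1)
    by (intro joint_tail_bigo_square landau_o.big_trans[OF tail_bigo_add(1) S]
        landau_o.big_trans[OF tail_bigo_add(2) S] real_distribution.finite_borel_measure_M)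
  moreover have "(\<lambda>x. joint_tail ?H ?H (h x) x) \<in> o[at_top](tail ?H)"
    using subexponential_iff_joint_tail[OF Hd(1) ins(3) h] H by blast
  ultimately have "?J \<in> o[at_top](tail ?H)"
    by (rule landau_o.big_small_trans)
  then have "(\<lambda>x. (tail ?H x - ?S x - ?J x) + ?J x) \<in> o[at_top](tail ?H)"
    by (intro sum_in_smallo landau_o.small_big_trans[OF E S])
  then have "(\<lambda>x. ?S x - tail ?H x) \<in> o[at_top](tail ?H)"
    by (subst landau_o.small.uminus_in_iff[symmetric]) (simp add: algebra_simps)
  then show ?thesis
    by (rule asymp_equiv_symI[OF smallo_imp_asymp_equiv])
qed

lemma real_distribution_mixture:
  assumes "real_distribution F" "real_distribution G" "0 \<le> p" "p \<le> 1"
  shows "real_distribution (mixture p F G)"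
proof -
  interpret F: real_distribution F by fact
  interpret G: real_distribution G by fact
  have sp: "space (mixture p F G) = UNIV"
    using sets_eq_imp_space_eq[OF sets_mixture] by simp
  have "emeasure (mixture p F G) UNIV = 1"
    using assms(3,4) F.emeasure_space_1 G.emeasure_space_1
    by (simp add: emeasure_mixture flip: ennreal_plus)
  then show ?thesis
    by (auto simp: real_distribution_def real_distribution_axioms_def sp intro!: prob_spaceI)
qed

lemma tail_mixture:
  assumes "real_distribution F" "real_distribution G" "0 \<le> p" "p \<le> 1"
  shows "tail (mixture p F G) x = p * tail F x + (1 - p) * tail G x"
proof -
  interpret F: real_distribution F by fact
  interpret G: real_distribution G by fact
  have "emeasure (mixture p F G) {x<..} =
      ennreal p * ennreal (tail F x) + ennreal (1 - p) * ennreal (tail G x)"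
    by (simp add: emeasure_mixture F.emeasure_eq_measure G.emeasure_eq_measure tail_def)
  also have "\<dots> = ennreal (p * tail F x + (1 - p) * tail G x)"
    using assms(3,4) by (simp add: ennreal_mult ennreal_plus)
  finally have "measure (mixture p F G) {x<..} = p * tail F x + (1 - p) * tail G x"
    using assms(3,4) by (intro measure_eq_emeasure_eq_ennreal) auto
  then show ?thesis
    by (simp add: tail_def)
qed

theorem theorem20:
  fixes F G :: "real measure" and p :: real and h :: "real \<Rightarrow> real"
  assumes "subexponential F" and "subexponential G"
    and "0 < p" and "p < 1"
    and "\<And>x. x \<ge> 0 \<Longrightarrow> h x > 0"
    and "filterlim h at_top at_top"
    and "\<forall>\<^sub>F x in at_top. h x \<le> x / 2"
    and "h_insensitive h F" and "h_insensitive h G"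
  shows "((\<lambda>x. tail (F \<star> G) x) \<sim>[at_top] (\<lambda>x. tail F x + tail G x)
            \<longleftrightarrow> subexponential (F \<star> G))
       \<and> (subexponential (F \<star> G) \<longleftrightarrow> subexponential (mixture p F G))
       \<and> (subexponential (mixture p F G)
            \<longleftrightarrow> (\<lambda>x. tail (restrict_gt F (h x) \<star> restrict_gt G (h x)) x)
                  \<in> o[at_top](\<lambda>x. tail F x + tail G x))"
proof -
  let ?S = "\<lambda>x. tail F x + tail G x" and ?M = "mixture p F G"
  have dist: "real_distribution F" "real_distribution G" and lt: "long_tailed F" "long_tailed G"
    using assms(1,2) by (auto simp: subexponential_def)
  note ins = assms(8,9) and h = assms(6,7)
  have i_iv: "tail (F \<star> G) \<sim>[at_top] ?S \<longleftrightarrow> (\<lambda>x. joint_tail F G (h x) x) \<in> o[at_top](?S)"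
    by (rule asymp_equiv_convolution_iff_joint_tail[OF dist ins h])
  have iii_iv: "subexponential ?M \<longleftrightarrow> (\<lambda>x. joint_tail F G (h x) x) \<in> o[at_top](?S)"
  proof (rule subexponential_iff_joint_tail_components[OF assms(1,2) ins _ _ h])
    have tail_M: "tail ?M = (\<lambda>x. p * tail F x + (1 - p) * tail G x)"
      using tail_mixture[OF dist] assms(3,4) by auto
    show dist_M: "real_distribution ?M"
      using real_distribution_mixture[OF dist] assms(3,4) by simp
    show "h_insensitive h ?M"
      using assms(3,4) dist_M h
      by (intro h_insensitive_of_tail_combination[OF ins, of _ p "1 - p"])
        (auto simp: tail_M real_distribution.finite_borel_measure_M)
    have "?S \<in> O[at_top](tail ?M)"
    proof (rule bigoI)
      have "?S x \<le> (1 / p + 1 / (1 - p)) * tail ?M x" for x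
      proof -
        have "?S x \<le> ?S x + ((1 - p) / p * tail G x + p / (1 - p) * tail F x)"
          using assms(3,4) by simp
        also have "\<dots> = (1 / p + 1 / (1 - p)) * tail ?M x"
          using assms(3,4) by (simp add: tail_M field_simps)
        finally show ?thesis .
      qed
      then show "\<forall>\<^sub>F x in at_top. norm (?S x) \<le> (1 / p + 1 / (1 - p)) * norm (tail ?M x)"
        by simp
    qed
    moreover have "tail ?M \<in> O[at_top](?S)"
      using assms(3,4)
      by (intro bigoI[where c = 1])
        (auto simp: tail_M intro!: always_eventually add_mono mult_left_le_one_le)
    ultimately show "tail ?M \<in> \<Theta>[at_top](?S)"
      by (auto simp: bigtheta_def bigomega_iff_bigo)
  qed
  have i_ii: "tail (F \<star> G) \<sim>[at_top] ?S \<longleftrightarrow> subexponential (F \<star> G)"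
  proof
    assume i: "tail (F \<star> G) \<sim>[at_top] ?S"
    have dist_FG: "real_distribution (F \<star> G)"
      by (rule real_distribution_convolution[OF dist])
    have "h_insensitive h (F \<star> G)"
      using i dist_FG h
      by (intro h_insensitive_of_tail_combination[OF ins, of _ 1 1])
        (auto simp: real_distribution.finite_borel_measure_M)
    then show "subexponential (F \<star> G)"
      using subexponential_iff_joint_tail_components[OF assms(1,2) ins dist_FG _ h]
        asymp_equiv_imp_bigtheta[OF i] i i_iv by blast
  qed (rule asymp_equiv_of_subexponential_convolution[OF dist(1) lt(1) dist(2) lt(2)])
  show ?thesis
    using i_iv iii_iv i_ii by (simp add: joint_tail_def)
qed

end
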